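(* Let $\Lambda$ be a lattice in $\mathbb{R}^d$, $d\ge 2$, let $s(\Lambda)$ be the length of the shortest non-zero vector of $\Lambda$, and let $0<\epsilon<s(\Lambda)/2$. Write $E=\Lambda+B_\epsilon(0)$. Then there is no finite set of orthogonal $d\times d$ matrices $O_1,\ldots,O_n$ such that $\bigcup_{j=1}^n O_jE$ contains the complement of a ball.
   Context: A lattice in $\mathbb{R}^d$ is a discrete subgroup of $\mathbb{R}^d$ of rank $d$. $B_\epsilon(0)=\{x\in\mathbb{R}^d:|x|<\epsilon\}$ with the Euclidean norm, $\Lambda+B_\epsilon(0)=\{\lambda+b:\lambda\in\Lambda,b\in B_\epsilon(0)\}$, and $O_jE=\{O_jx:x\in E\}$. *)

theory Defs
  imports "HOL-Analysis.Analysis"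
begin

definition int_scale :: "int \<Rightarrow> 'a::real_vector \<Rightarrow> 'a"
  where "int_scale k x = of_int k *\<^sub>R x"

interpretation int_module: module "int_scale :: int \<Rightarrow> 'a::real_vector \<Rightarrow> 'a"
  by unfold_locales (simp_all add: int_scale_def algebra_simps)

definition add_subgroup :: "'a::ab_group_add set \<Rightarrow> bool"
  where "add_subgroup G \<longleftrightarrow>
    0 \<in> G \<and> (\<forall>x\<in>G. \<forall>y\<in>G. x + y \<in> G) \<and> (\<forall>x\<in>G. - x \<in> G)"

text \<open>
  The rank of an abelian group is the largest cardinality of a subset that is linearly
  independent over the integers; it is \<open>\<infinity>\<close> if there is no such bound.  (Independence over the
  reals is a different notion: the rank of a non-discrete subgroup can exceed the dimension.)
\<close>

definition group_rank :: "'a::real_vector set \<Rightarrow> enat"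
  where "group_rank G =
    (SUP B\<in>{B. B \<subseteq> G \<and> finite B \<and> int_module.independent B}. enat (card B))"

definition is_lattice :: "'a::euclidean_space set \<Rightarrow> bool"
  where "is_lattice L \<longleftrightarrow> add_subgroup L \<and> discrete L \<and> group_rank L = enat DIM('a)"

text \<open>
  The underlying choice is harmless: minimizers differ at most in direction.  A lattice of
  positive rank always has one, since its intersection with every ball is finite.
\<close>

definition shortest_length :: "'a::real_normed_vector set \<Rightarrow> real"
  where "shortest_length L = norm (ARG_MIN norm x. x \<in> L \<and> x \<noteq> 0)"

definition set_sum :: "'a::plus set \<Rightarrow> 'a set \<Rightarrow> 'a set"
  where "set_sum A B = {a + b | a b. a \<in> A \<and> b \<in> B}"

end

theory Submission
  imports Defs
begin

text \<open>
  Suppose first that \<open>\<Lambda>\<close> spans the space, and write \<open>s\<close> for its shortest length.  Since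
  \<open>\<epsilon> < s / 2\<close>, a vector \<open>x\<close> of length \<open>s / 2\<close> lies at distance at least \<open>s / 2 > \<epsilon>\<close> from every
  rotated copy of \<open>\<Lambda>\<close>, so no rotated copy of \<open>E\<close> covers it.  The flow
  \<open>t \<mapsto> (O\<^sub>1\<^sup>T t, \<dots>, O\<^sub>n\<^sup>T t)\<close> on the compact torus \<open>(\<real>\<^sup>d / \<Lambda>)\<^sup>n\<close> is recurrent: there
  are arbitrarily large \<open>t\<close> such that each \<open>O\<^sub>j\<^sup>T t\<close> is close to \<open>\<Lambda>\<close>.  For such \<open>t\<close> the point
  \<open>x + t\<close> is uncovered as well.

  If \<open>\<Lambda>\<close> does not span, every rotated copy of \<open>E\<close> lies in a slab around a hyperplane, and finitely
  many slabs do not cover the complement of a ball.  Treating this case separately avoids comparing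
  linear independence over the integers and over the reals.
\<close>

section \<open>Integer combinations in additive subgroups\<close>

lemma add_subgroup_zero: "add_subgroup G \<Longrightarrow> 0 \<in> G"
  and add_subgroup_add: "add_subgroup G \<Longrightarrow> x \<in> G \<Longrightarrow> y \<in> G \<Longrightarrow> x + y \<in> G"
  and add_subgroup_minus: "add_subgroup G \<Longrightarrow> x \<in> G \<Longrightarrow> - x \<in> G"
  by (auto simp: add_subgroup_def)

lemma add_subgroup_diff: "add_subgroup G \<Longrightarrow> x \<in> G \<Longrightarrow> y \<in> G \<Longrightarrow> x - y \<in> G"
  using add_subgroup_add[of G x "- y"] add_subgroup_minus[of G y] by simp

lemma add_subgroup_scaleR_nat:
  fixes G :: "'a::real_vector set"
  assumes "add_subgroup G" "x \<in> G"
  shows "of_nat n *\<^sub>R x \<in> G"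
  by (induction n) (simp_all add: assms add_subgroup_zero add_subgroup_add algebra_simps)

lemma add_subgroup_scaleR_int:
  fixes G :: "'a::real_vector set"
  assumes "add_subgroup G" "x \<in> G"
  shows "of_int k *\<^sub>R x \<in> G"
proof (cases k)
  case (nonneg n)
  then show ?thesis using add_subgroup_scaleR_nat[OF assms] by simp
next
  case (neg n)
  have "- (of_nat (Suc n) *\<^sub>R x) \<in> G"
    by (intro add_subgroup_minus add_subgroup_scaleR_nat assms)
  then show ?thesis using neg by (metis of_int_minus of_int_of_nat_eq scaleR_minus_left)
qed

lemma add_subgroup_sum:
  assumes "add_subgroup G" "\<And>i. i \<in> I \<Longrightarrow> f i \<in> G"
  shows "sum f I \<in> G"
  using assms(2)
  by (induction I rule: infinite_finite_induct)
     (auto intro: add_subgroup_zero add_subgroup_add assms(1))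

section \<open>Discreteness and shortest vectors\<close>

text \<open>Differences stay in the group, so a radius that isolates 0 separates any two
  points.\<close>

lemma discrete_add_subgroup_imp_uniform_discrete:
  fixes G :: "'a::real_normed_vector set"
  assumes G: "add_subgroup G" and "discrete G"
  shows "uniform_discrete G"
proof -
  have "0 isolated_in G"
    using assms add_subgroup_zero discreteD by blast
  then obtain e where "e > 0" and e: "\<And>y. y \<in> G \<Longrightarrow> dist 0 y < e \<Longrightarrow> y = 0"
    unfolding isolated_in_dist_Ex_iff by blast
  show ?thesis
  proof (rule uniformI1[OF \<open>e > 0\<close>])
    fix x y assume "x \<in> G" "y \<in> G" "dist x y < e"
    then have "x - y = 0"
      using e[of "x - y"] add_subgroup_diff[OF G] by (simp add: dist_norm norm_minus_commute)
    then show "x = y" by simp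
  qed
qed

text \<open>The choice operator \<open>ARG_MIN\<close> is meaningful only once a minimizer exists.
  It does, because a bounded uniformly discrete set is finite.\<close>

lemma shortest_length_le_norm:
  fixes L :: "'a::euclidean_space set"
  assumes L: "add_subgroup L" and "discrete L" and x: "x \<in> L" "x \<noteq> 0"
  shows "shortest_length L \<le> norm x"
proof -
  define S where "S = {y \<in> L. y \<noteq> 0 \<and> norm y \<le> norm x}"
  have "uniform_discrete S"
    using discrete_add_subgroup_imp_uniform_discrete[OF assms(1,2)]
    by (rule uniform_discrete_subset) (auto simp: S_def)
  moreover have "bounded S"
    by (rule boundedI[of _ "norm x"]) (auto simp: S_def)
  ultimately have "finite S"
    using uniform_discrete_finite_iff by blast
  moreover have "S \<noteq> {}" using x by (auto simp: S_def)
  ultimately obtain m where m: "is_arg_min norm (\<lambda>y. y \<in> S) m"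
    using ex_is_arg_min_if_finite[of S norm] by blast
  \<comment> \<open>Members of \<open>L\<close> outside \<open>S\<close> are 0 or longer than
    \<open>x\<close>, which itself lies in \<open>S\<close>; so minimality extends from
    \<open>S\<close> to all nonzero vectors.\<close>
  then have "m \<in> L" "m \<noteq> 0" and min: "norm m \<le> norm y" if "y \<in> L" "y \<noteq> 0" for y
    using that by (force simp: is_arg_min_linorder S_def)+
  then have "norm (ARG_MIN norm x. x \<in> L \<and> x \<noteq> 0) = norm m"
    using x by (intro arg_min_equality) auto
  then show ?thesis
    using min x by (simp add: shortest_length_def)
qed

section \<open>Cocompactness and recurrence\<close>

text \<open>Choose a real basis inside \<open>L\<close> and round all coordinates down: the error
  has coefficients in [0, 1).\<close>

lemma add_subgroup_spanning_cocompact: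
  fixes L :: "'a::euclidean_space set"
  assumes L: "add_subgroup L" and "span L = UNIV"
  obtains R where "\<And>y. \<exists>l\<in>L. norm (y - l) \<le> R"
proof -
  obtain B where B: "B \<subseteq> L" "independent B" "L \<subseteq> span B"
    using maximal_independent_subset by blast
  have fin: "finite B" using B(2) independent_bound by blast
  have "span B = UNIV"
    using span_mono[OF B(3)] assms(2) by (simp add: span_span top.extremum_unique)
  have "\<exists>l\<in>L. norm (y - l) \<le> (\<Sum>b\<in>B. norm b)" for y
  proof -
    have "y \<in> range (\<lambda>c. \<Sum>b\<in>B. c b *\<^sub>R b)"
      using \<open>span B = UNIV\<close> by (simp flip: span_finite[OF fin])
    then obtain c where c: "y = (\<Sum>b\<in>B. c b *\<^sub>R b)" by blast
    define l where "l = (\<Sum>b\<in>B. of_int \<lfloor>c b\<rfloor> *\<^sub>R b)"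
    have "l \<in> L"
      unfolding l_def using B(1) by (intro add_subgroup_sum add_subgroup_scaleR_int L) auto
    moreover have "norm (y - l) \<le> (\<Sum>b\<in>B. norm b)"
    proof -
      have "y - l = (\<Sum>b\<in>B. frac (c b) *\<^sub>R b)"
        by (simp add: c l_def frac_def sum_subtractf scaleR_left_diff_distrib)
      also have "norm \<dots> \<le> (\<Sum>b\<in>B. norm b)"
        by (intro sum_norm_le)
           (simp add: mult_left_le_one_le frac_ge_0 less_imp_le[OF frac_lt_1])
      finally show ?thesis .
    qed
    ultimately show ?thesis by blast
  qed
  then show thesis by (rule that)
qed

text \<open>Bolzano-Weierstrass once per index; convergence already achieved survives each further
  refinement.\<close>

lemma bounded_family_convergent_subsequence:
  fixes f :: "'i \<Rightarrow> nat \<Rightarrow> 'a::heine_borel"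
  assumes "finite J" "\<And>j. j \<in> J \<Longrightarrow> bounded (range (f j))"
  obtains r :: "nat \<Rightarrow> nat" where "strict_mono r" "\<And>j. j \<in> J \<Longrightarrow> convergent (f j \<circ> r)"
proof -
  have "\<exists>r::nat\<Rightarrow>nat. strict_mono r \<and> (\<forall>j\<in>J. convergent (f j \<circ> r))"
    using assms
  proof (induction J rule: finite_induct)
    case empty
    show ?case by (rule exI[of _ id]) (simp add: strict_mono_def)
  next
    case (insert i J)
    then obtain r :: "nat \<Rightarrow> nat" where r: "strict_mono r" "\<forall>j\<in>J. convergent (f j \<circ> r)"
      by (meson insertI2)
    have "bounded (range (f i \<circ> r))"
      using insert.prems[OF insertI1] by (rule bounded_subset) auto
    then obtain l and q :: "nat \<Rightarrow> nat"
      where q: "strict_mono q" "((f i \<circ> r) \<circ> q) \<longlonglongrightarrow> l"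
      using bounded_imp_convergent_subsequence by blast
    have "convergent (f j \<circ> (r \<circ> q))" if "j \<in> J" for j
      using convergent_subseq_convergent[of "f j \<circ> r" q] r(2) q(1) that by (simp add: comp_assoc)
    moreover have "convergent (f i \<circ> (r \<circ> q))"
      using q(2) by (auto simp: convergent_def comp_assoc)
    moreover have "strict_mono (r \<circ> q)"
      using r(1) q(1) by (rule strict_mono_o)
    ultimately show ?case by blast
  qed
  then show thesis using that by blast
qed

text \<open>Along a suitable subsequence of the multiples of a unit vector, the residues modulo
  \<open>L\<close> converge for all \<open>j\<close> at once. The difference of two late times then
  returns close to \<open>L\<close>.\<close>

lemma simultaneous_return_times:
  fixes L :: "'a::euclidean_space set" and g :: "'i \<Rightarrow> 'b::euclidean_space \<Rightarrow> 'a"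
  assumes L: "add_subgroup L" "span L = UNIV"
    and J: "finite J" "\<And>j. j \<in> J \<Longrightarrow> linear (g j)"
    and "\<delta> > 0"
  obtains t where "norm t > C" "\<And>j. j \<in> J \<Longrightarrow> \<exists>l\<in>L. norm (g j t - l) < \<delta>"
proof -
  obtain R where R: "\<And>y. \<exists>l\<in>L. norm (y - l) \<le> R"
    using add_subgroup_spanning_cocompact[OF L] by blast
  obtain u :: 'b where u: "norm u = 1" using norm_Basis nonempty_Basis by blast
  obtain p where p: "\<And>y. p y \<in> L" "\<And>y. norm (y - p y) \<le> R"
    using R by metis
  \<comment> \<open>A representative modulo \<open>L\<close> of norm at most \<open>R\<close>,
    standing in for a point of the compact torus.\<close>
  define f where "f j k = g j (of_nat k *\<^sub>R u) - p (g j (of_nat k *\<^sub>R u))" for j and k :: nat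
  have "bounded (range (f j))" for j
    using p(2) by (intro boundedI[of _ R]) (auto simp: f_def)
  then obtain r :: "nat \<Rightarrow> nat" where r: "strict_mono r" "\<And>j. j \<in> J \<Longrightarrow> convergent (f j \<circ> r)"
    using bounded_family_convergent_subsequence[OF J(1)] by blast
  have "\<forall>j\<in>J. \<exists>N. \<forall>m\<ge>N. \<forall>n\<ge>N. norm (f j (r m) - f j (r n)) < \<delta>"
  proof
    fix j assume "j \<in> J"
    then have "Cauchy (f j \<circ> r)" using r(2) convergent_Cauchy by blast
    from CauchyD[OF this \<open>\<delta> > 0\<close>]
    show "\<exists>N. \<forall>m\<ge>N. \<forall>n\<ge>N. norm (f j (r m) - f j (r n)) < \<delta>" by simp
  qed
  then obtain M where "\<forall>j\<in>J. \<forall>m\<ge>M j. \<forall>n\<ge>M j. norm (f j (r m) - f j (r n)) < \<delta>"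
    by (rule bchoice[THEN exE])
  then have M: "\<And>j m n. j \<in> J \<Longrightarrow> m \<ge> M j \<Longrightarrow> n \<ge> M j \<Longrightarrow> norm (f j (r m) - f j (r n)) < \<delta>"
    by blast
  \<comment> \<open>The sum bounds every \<open>M j\<close> and also makes sense for empty
    \<open>J\<close>.\<close>
  define N where "N = (\<Sum>j\<in>J. M j)"
  have N: "M j \<le> N" if "j \<in> J" for j
    unfolding N_def using member_le_sum[of j J M] J(1) that by simp
  obtain K :: nat where K: "real K > C + real (r N)" using reals_Archimedean2 by blast
  \<comment> \<open>\<open>K\<close> makes the return time long, since \<open>r n\<close> is at
    least \<open>n\<close>; \<open>N\<close> keeps \<open>n\<close> in the Cauchy range.\<close>
  define n where "n = max K N"
  have "real (r n) \<ge> real K"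
    using seq_suble[OF r(1), of n] unfolding n_def by linarith
  define t where "t = of_nat (r n) *\<^sub>R u - of_nat (r N) *\<^sub>R u"
  show thesis
  proof
    have "norm t = \<bar>real (r n) - real (r N)\<bar>"
      by (simp add: t_def u flip: scaleR_left_diff_distrib)
    then show "norm t > C" using K \<open>real (r n) \<ge> real K\<close> by linarith
  next
    fix j assume j: "j \<in> J"
    let ?l = "p (g j (of_nat (r n) *\<^sub>R u)) - p (g j (of_nat (r N) *\<^sub>R u))"
    have "g j t - ?l = f j (r n) - f j (r N)"
      by (simp add: t_def f_def linear_diff[OF J(2)[OF j]])
    moreover have "norm (f j (r n) - f j (r N)) < \<delta>"
      using M[OF j] N[OF j] by (simp add: n_def)
    ultimately show "\<exists>l\<in>L. norm (g j t - l) < \<delta>"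
      using add_subgroup_diff[OF L(1) p(1) p(1)] by metis
  qed
qed

section \<open>Uncovered points far from the origin\<close>

lemma unbounded_uncovered_spanning:
  fixes L :: "'a::euclidean_space set" and g :: "'i \<Rightarrow> 'a \<Rightarrow> 'a"
  assumes L: "add_subgroup L" "span L = UNIV"
    and s: "\<And>l. l \<in> L \<Longrightarrow> l \<noteq> 0 \<Longrightarrow> s \<le> norm l"
    and \<epsilon>: "0 < \<epsilon>" "\<epsilon> < s / 2"
    and J: "finite J" "\<And>j. j \<in> J \<Longrightarrow> orthogonal_transformation (g j)"
  obtains y where "norm y > C" "\<And>j. j \<in> J \<Longrightarrow> g j y \<notin> set_sum L (ball 0 \<epsilon>)"
proof -
  have "linear (g j)" if "j \<in> J" for j
    using J(2)[OF that] by (simp add: orthogonal_transformation)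
  then obtain t where t: "norm t > C + s / 2"
      "\<And>j. j \<in> J \<Longrightarrow> \<exists>l\<in>L. norm (g j t - l) < s / 2 - \<epsilon>"
    using simultaneous_return_times[OF L J(1), of g "s / 2 - \<epsilon>" "C + s / 2"] \<epsilon> by auto
  obtain u :: 'a where u: "norm u = 1" using norm_Basis nonempty_Basis by blast
  define x where "x = (s / 2) *\<^sub>R u"
  have x: "norm x = s / 2" using u \<epsilon> by (simp add: x_def)
  show thesis
  proof
    have "norm t \<le> norm (x + t) + norm x"
      using norm_triangle_ineq4[of "x + t" x] by simp
    then show "norm (x + t) > C" using t(1) x by linarith
  next
    fix j assume j: "j \<in> J"
    obtain k where k: "k \<in> L" "norm (g j t - k) < s / 2 - \<epsilon>" using t(2)[OF j] by blast
    have gj: "linear (g j)" "norm (g j x) = s / 2"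
      using J(2)[OF j] x by (auto simp: orthogonal_transformation)
    show "g j (x + t) \<notin> set_sum L (ball 0 \<epsilon>)"
    proof
      assume "g j (x + t) \<in> set_sum L (ball 0 \<epsilon>)"
      then obtain l b where lb: "l \<in> L" "norm b < \<epsilon>" "g j (x + t) = l + b"
        by (auto simp: set_sum_def)
      have "g j x = l + b - g j t"
        using lb(3) linear_add[OF gj(1), of x t] by (simp add: eq_diff_eq)
      \<comment> \<open>Shifting by the lattice point \<open>k\<close> trades the return error
        against \<open>\<epsilon>\<close>; the tolerance \<open>s / 2 - \<epsilon>\<close> was
        chosen so that the two add up to less than \<open>s / 2\<close>.\<close>
      then have "g j x - (l - k) = b - (g j t - k)"
        by simp
      then have "norm (g j x - (l - k)) = norm (b - (g j t - k))"
        by (rule arg_cong)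
      also have "\<dots> \<le> norm b + norm (g j t - k)"
        by (rule norm_triangle_ineq4)
      also have "\<dots> < s / 2" using lb(2) k(2) by linarith
      finally have near: "norm (g j x - (l - k)) < s / 2" .
      show False
      proof (cases "l - k = 0")
        case True
        then show False using near gj(2) by simp
      next
        case False
        then have "s \<le> norm (l - k)"
          using s add_subgroup_diff[OF L(1) lb(1) k(1)] by blast
        also have "\<dots> \<le> norm (g j x) + norm (g j x - (l - k))"
          using norm_triangle_ineq4[of "g j x" "g j x - (l - k)"] by simp
        finally show False using near gj(2) by linarith
      qed
    qed
  qed
qed

text \<open>With \<open>a\<close> normal to \<open>L\<close>, membership of \<open>g j y\<close> in
  the thickened set bounds the inner product of \<open>a\<close> and \<open>g j y\<close>. A
  direction off finitely many hyperplanes escapes all these slabs when scaled up.\<close>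

lemma unbounded_uncovered_nonspanning:
  fixes L :: "'a::euclidean_space set" and g :: "'i \<Rightarrow> 'a \<Rightarrow> 'a"
  assumes "span L \<noteq> UNIV"
    and J: "finite J" "\<And>j. j \<in> J \<Longrightarrow> orthogonal_transformation (g j)"
  obtains y where "norm y > C" "\<And>j. j \<in> J \<Longrightarrow> g j y \<notin> set_sum L (ball 0 \<epsilon>)"
proof -
  obtain a where a: "a \<noteq> 0" "\<And>l. l \<in> L \<Longrightarrow> a \<bullet> l = 0"
    using span_not_UNIV_orthogonal[OF assms(1)] span_base by blast
  have lin: "linear (g j)" if "j \<in> J" for j
    using J(2)[OF that] by (simp add: orthogonal_transformation)
  \<comment> \<open>This is a hyperplane with normal \<open>adjoint (g j) a\<close>, nonzero because
    \<open>g j\<close> is surjective. Null sets then show that finitely many hyperplanes miss a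
    point.\<close>
  have "negligible {x. a \<bullet> g j x = 0}" if j: "j \<in> J" for j
  proof -
    have "adjoint (g j) a \<noteq> 0"
    proof
      assume "adjoint (g j) a = 0"
      then have "a \<bullet> g j x = 0" for x
        using adjoint_works[OF lin[OF j], of x a] by (simp add: inner_commute)
      moreover obtain x where "a = g j x"
        using orthogonal_transformation_surj[OF J(2)[OF j]] by (metis surjD)
      ultimately show False using a(1) by (metis inner_eq_zero_iff)
    qed
    moreover have "{x. a \<bullet> g j x = 0} = {x. adjoint (g j) a \<bullet> x = 0}"
      using adjoint_works[OF lin[OF j], of _ a] by (auto simp: inner_commute)
    ultimately show ?thesis using negligible_hyperplane by metis
  qed
  \<comment> \<open>Inserting 0 makes \<open>v\<close> nonzero even when \<open>J\<close> is
    empty.\<close>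
  then have "negligible (insert 0 (\<Union>j\<in>J. {x. a \<bullet> g j x = 0}))"
    using J(1) by (auto intro!: negligible_Union simp: negligible_insert)
  then have "insert 0 (\<Union>j\<in>J. {x. a \<bullet> g j x = 0}) \<noteq> UNIV"
    using non_negligible_UNIV by metis
  then obtain v where v: "v \<noteq> 0" "\<And>j. j \<in> J \<Longrightarrow> a \<bullet> g j v \<noteq> 0" by blast
  \<comment> \<open>The first term handles the length, each summand one slab, and the final 1 makes
    the inequalities strict.\<close>
  define M where "M = \<bar>C\<bar> / norm v + (\<Sum>j\<in>J. \<bar>norm a * \<epsilon>\<bar> / \<bar>a \<bullet> g j v\<bar>) + 1"
  have M0: "M > 0" unfolding M_def by (intro add_nonneg_pos add_nonneg_nonneg sum_nonneg) auto
  show thesis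
  proof
    have "M > \<bar>C\<bar> / norm v"
      unfolding M_def by (simp add: add_nonneg_pos sum_nonneg flip: add.assoc)
    then show "norm (M *\<^sub>R v) > C"
      using v(1) M0 by (simp add: field_simps)
  next
    fix j assume j: "j \<in> J"
    have "\<bar>norm a * \<epsilon>\<bar> / \<bar>a \<bullet> g j v\<bar> \<le> (\<Sum>j\<in>J. \<bar>norm a * \<epsilon>\<bar> / \<bar>a \<bullet> g j v\<bar>)"
      using J(1) j by (intro member_le_sum) auto
    moreover have "\<bar>C\<bar> / norm v \<ge> 0" by simp
    ultimately have "M > \<bar>norm a * \<epsilon>\<bar> / \<bar>a \<bullet> g j v\<bar>"
      unfolding M_def by linarith
    then have far: "\<bar>a \<bullet> g j (M *\<^sub>R v)\<bar> > \<bar>norm a * \<epsilon>\<bar>"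
      using v(2)[OF j] M0 by (simp add: linear_scale[OF lin[OF j]] abs_mult field_simps)
    show "g j (M *\<^sub>R v) \<notin> set_sum L (ball 0 \<epsilon>)"
    proof
      assume "g j (M *\<^sub>R v) \<in> set_sum L (ball 0 \<epsilon>)"
      then obtain l b where lb: "l \<in> L" "norm b < \<epsilon>" "g j (M *\<^sub>R v) = l + b"
        by (auto simp: set_sum_def)
      then have "\<bar>a \<bullet> g j (M *\<^sub>R v)\<bar> = \<bar>a \<bullet> b\<bar>"
        using a(2) by (simp add: inner_add_right)
      also have "\<dots> \<le> norm a * norm b" by (rule Cauchy_Schwarz_ineq2)
      also have "\<dots> \<le> norm a * \<epsilon>" using lb(2) by (intro mult_left_mono) auto
      finally show False using far by linarith
    qed
  qed
qed

theorem theorem2: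
  fixes \<Lambda> E :: "(real ^ 'd) set" and \<epsilon> :: real
  assumes dim: "CARD('d) \<ge> 2"
    and lattice: "is_lattice \<Lambda>"
    and eps: "0 < \<epsilon>" "\<epsilon> < shortest_length \<Lambda> / 2"
    and E_def: "E = set_sum \<Lambda> (ball 0 \<epsilon>)"
  shows "\<not> (\<exists>(n::nat) Q :: nat \<Rightarrow> real ^ 'd ^ 'd.
            (\<forall>j\<in>{1..n}. orthogonal_matrix (Q j)) \<and>
            (\<exists>c r. r > 0 \<and> - ball c r \<subseteq> (\<Union>j\<in>{1..n}. (\<lambda>x. Q j *v x) ` E)))"
proof (intro notI, elim exE conjE)
  fix n :: nat and Q :: "nat \<Rightarrow> real ^ 'd ^ 'd" and c r
  assume Q: "\<forall>j\<in>{1..n}. orthogonal_matrix (Q j)"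
    and cover: "- ball c r \<subseteq> (\<Union>j\<in>{1..n}. (\<lambda>x. Q j *v x) ` E)"
  have L: "add_subgroup \<Lambda>" "discrete \<Lambda>" using lattice by (auto simp: is_lattice_def)
  \<comment> \<open>By orthogonality the transpose inverts \<open>Q j\<close>, so a point outside
    the rotated copy of \<open>E\<close> is one that \<open>g j\<close> sends outside
    \<open>E\<close>.\<close>
  define g where "g j = (*v) (transpose (Q j))" for j
  have g: "orthogonal_transformation (g j)" if "j \<in> {1..n}" for j
    using Q that unfolding g_def
    by (simp add: orthogonal_transformation_matrix orthogonal_matrix_transpose)
  have inv: "g j (Q j *v x) = x" if "j \<in> {1..n}" for j x
    using Q that unfolding g_def
    by (simp add: matrix_vector_mul_assoc orthogonal_matrix_def)
  \<comment> \<open>The summand \<open>norm c\<close> allows for a ball not centred at the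
    origin.\<close>
  obtain y where y: "norm y > norm c + r" "\<And>j. j \<in> {1..n} \<Longrightarrow> g j y \<notin> E"
  proof (cases "span \<Lambda> = UNIV")
    case True
    show thesis
      by (rule unbounded_uncovered_spanning[OF L(1) True shortest_length_le_norm[OF L] eps,
            where J = "{1..n}" and g = g and C = "norm c + r", folded E_def])
         (use g that in blast)+
  next
    case False
    show thesis
      by (rule unbounded_uncovered_nonspanning[OF False,
            where J = "{1..n}" and g = g and C = "norm c + r" and \<epsilon> = \<epsilon>, folded E_def])
         (use g that in blast)+
  qed
  have "norm y - norm c \<le> dist c y"
    by (metis dist_commute dist_norm norm_triangle_ineq2)
  then have "y \<in> - ball c r" using y(1) by simp
  then obtain j x where "j \<in> {1..n}" "x \<in> E" "y = Q j *v x" using cover by blast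
  then show False using y(2) inv by metis
qed

end
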